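(* For every (finite, simple, connected) graph $G$ and every integer $n\geq 2\beta(G)+1$, we have $\beta(K_n\,\square\,G)=n-1$.
   Context: $K_n$ is the complete graph on $n$ vertices. $d(v,w)$ denotes shortest-path distance. A vertex $x$ resolves $v,w$ if $d(v,x)\neq d(w,x)$; a set resolves a graph if every pair of distinct vertices is resolved by some vertex of the set; $\beta(G)$ is the minimum size of a resolving set. The cartesian product $G\,\square\,H$ has vertex set $V(G)\times V(H)$, with $(a,v)\sim(b,w)$ iff ($a=b$ and $vw\in E(H)$) or ($v=w$ and $ab\in E(G)$). *)

theory Defs
  imports "Graph_Theory.Graph_Theory"
begin

text \<open>
  Finite simple graphs are the loop-free symmetric digraphs of the locale \<^locale>\<open>pair_graph\<close>:
  an undirected edge \<open>vw\<close> is the pair of arcs \<open>(v, w)\<close> and \<open>(w, v)\<close>.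
\<close>

text \<open>
  The shortest-path distance, as the library's weighted distance with unit weights. It is
  extended-real valued, and infinite between different components.
\<close>
definition graph_dist :: "'a pair_pre_digraph \<Rightarrow> 'a \<Rightarrow> 'a \<Rightarrow> ereal" where
  "graph_dist G v w = wf_digraph.\<mu> (with_proj G) (\<lambda>_. 1) v w"

definition resolves :: "'a pair_pre_digraph \<Rightarrow> 'a \<Rightarrow> 'a \<Rightarrow> 'a \<Rightarrow> bool" where
  "resolves G x v w \<longleftrightarrow> graph_dist G v x \<noteq> graph_dist G w x"

definition resolving_set :: "'a pair_pre_digraph \<Rightarrow> 'a set \<Rightarrow> bool" where
  "resolving_set G S \<longleftrightarrow> S \<subseteq> pverts G \<and>
     (\<forall>v \<in> pverts G. \<forall>w \<in> pverts G. v \<noteq> w \<longrightarrow> (\<exists>x \<in> S. resolves G x v w))"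

definition metric_dimension :: "'a pair_pre_digraph \<Rightarrow> nat" where
  "metric_dimension G = (LEAST k. \<exists>S. resolving_set G S \<and> finite S \<and> card S = k)"

definition cartesian_product ::
    "'a pair_pre_digraph \<Rightarrow> 'b pair_pre_digraph \<Rightarrow> ('a \<times> 'b) pair_pre_digraph"
    (infixr \<open>\<box>\<close> 70) where
  "G \<box> H = \<lparr> pverts = pverts G \<times> pverts H,
     parcs = {((a, v), (b, w)).
       (a = b \<and> a \<in> pverts G \<and> (v, w) \<in> parcs H) \<or>
       (v = w \<and> v \<in> pverts H \<and> (a, b) \<in> parcs G)} \<rparr>"

end

theory Submission
  imports Defs
begin

text \<open>
  Distances in \<open>K \<box> G\<close> are sums \<open>d(a, b) + d(v, w)\<close> of distances in the factors. If a set misses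
  two of the \<open>n\<close> fibres \<open>{a} \<times> V(G)\<close>, it cannot resolve two vertices in these fibres over the same
  vertex of \<open>G\<close>; hence a resolving set has at least \<open>n - 1\<close> elements. Conversely, choose one vertex
  \<open>(i, g i)\<close> in each fibre but one, such that \<open>g\<close> takes every value in a metric basis of \<open>G\<close> at
  least twice. A basis vertex \<open>s\<close> resolving \<open>v, w\<close> then also resolves \<open>(a, v), (b, w)\<close> through some
  \<open>(i, s)\<close>: any \<open>i\<close> outside \<open>{a, b}\<close> does, and if the only choices are \<open>i = a\<close> and \<open>i = b\<close>, failure
  of both would give \<open>d(v, s) = d(w, s) + 1\<close> and \<open>d(w, s) = d(v, s) + 1\<close>.
\<close>

section \<open>Distances\<close>

context pair_wf_digraph
begin

lemma awalk_cost_one: "awalk_cost (\<lambda>_. 1) p = length p"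
  by (induction p) auto

text \<open>With unit weights the cost of a walk is its length. Upper bounds on the distance then
  come from exhibiting one walk, lower bounds from inspecting all walks.\<close>

lemma graph_dist_eq_INF: "graph_dist G u v = (INF p\<in>{p. awalk u p v}. ereal (length p))"
  by (simp add: graph_dist_def \<mu>_def awalk_cost_one)

lemma graph_dist_le: "awalk u p v \<Longrightarrow> graph_dist G u v \<le> ereal (length p)"
  unfolding graph_dist_eq_INF by (auto intro: INF_lower)

lemma graph_dist_nonneg: "0 \<le> graph_dist G u v"
  unfolding graph_dist_eq_INF by (auto intro: INF_greatest)

lemma graph_dist_refl: "v \<in> pverts G \<Longrightarrow> graph_dist G v v = 0"
  using graph_dist_le[of v "[]" v] graph_dist_nonneg[of v v]
  by (auto simp: awalk_Nil_iff zero_ereal_def)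

lemma graph_dist_ge_1:
  assumes "u \<noteq> v"
  shows "1 \<le> graph_dist G u v"
  unfolding graph_dist_eq_INF
proof (rule INF_greatest)
  fix p assume "p \<in> {p. awalk u p v}"
  with assms show "1 \<le> ereal (length p)"
    by (cases p) (auto simp: awalk_Nil_iff one_ereal_def)
qed

lemma graph_dist_eq_infinity_iff: "graph_dist G u v = \<infinity> \<longleftrightarrow> \<not> reachable (with_proj G) u v"
  using \<mu>_reach_conv[of "\<lambda>_. 1" u v] by (auto simp: graph_dist_def)

end

text \<open>Nonnegative weights on a finite digraph make the infimum a minimum over paths as soon as
  some walk exists, that is, as soon as the distance is finite.\<close>

lemma (in pair_fin_digraph) graph_dist_attained:
  assumes "graph_dist G u v \<noteq> \<infinity>"
  obtains p where "awalk u p v" "graph_dist G u v = ereal (length p)"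
proof -
  have "reachable (with_proj G) u v" using assms by (simp add: graph_dist_eq_infinity_iff)
  then obtain p where "apath u p v" "\<mu> (\<lambda>_. 1) u v = awalk_cost (\<lambda>_. 1) p"
    using min_cost_awalk[of u v "\<lambda>_. 1"] by auto
  then show thesis
    using that[of p] by (simp add: graph_dist_def awalk_cost_one awalkI_apath)
qed

lemma graph_dist_complete:
  assumes "complete_digraph n (with_proj K)" "a \<in> pverts K" "b \<in> pverts K"
  shows "graph_dist K a b = (if a = b then 0 else 1)"
proof -
  interpret K: pair_graph K using assms(1) by (rule pair_graphI_complete)
  show ?thesis
  proof (cases "a = b")
    case True
    then show ?thesis using assms by (simp add: K.graph_dist_refl)
  next
    case False
    then have "K.awalk a [(a, b)] b"
      using assms by (auto simp: complete_digraph_pair_def K.awalk_simps)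
    from K.graph_dist_le[OF this] have "graph_dist K a b \<le> 1"
      by (simp add: one_ereal_def)
    with False K.graph_dist_ge_1[of a b] show ?thesis by simp
  qed
qed

section \<open>Distances in cartesian products\<close>

lemma pverts_cartesian_product [simp]: "pverts (K \<box> G) = pverts K \<times> pverts G"
  by (simp add: cartesian_product_def)

lemma parcs_cartesian_product [simp]:
  "((a, v), (b, w)) \<in> parcs (K \<box> G) \<longleftrightarrow>
    a = b \<and> a \<in> pverts K \<and> (v, w) \<in> parcs G \<or> v = w \<and> v \<in> pverts G \<and> (a, b) \<in> parcs K"
  by (simp add: cartesian_product_def)

lemma pair_wf_digraph_cartesian_product:
  assumes "pair_wf_digraph K" "pair_wf_digraph G"
  shows "pair_wf_digraph (K \<box> G)"
proof -
  interpret K: pair_wf_digraph K by fact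
  interpret G: pair_wf_digraph G by fact
  show ?thesis
    by unfold_locales
      (auto simp: cartesian_product_def dest: K.wellformed' G.wellformed')
qed

locale pair_fin_digraph_product = K: pair_fin_digraph K + G: pair_fin_digraph G
  for K :: "'a pair_pre_digraph" and G :: "'b pair_pre_digraph"
begin

sublocale KG: pair_wf_digraph "K \<box> G"
  using K.pair_wf_digraph_axioms G.pair_wf_digraph_axioms by (rule pair_wf_digraph_cartesian_product)

lemma awalk_product_left:
  assumes "K.awalk a p b" "v \<in> pverts G"
  shows "KG.awalk (a, v) (map (\<lambda>(x, y). ((x, v), (y, v))) p) (b, v)"
  using assms by (induction p arbitrary: a) (auto simp: K.awalk_simps KG.awalk_simps)

lemma awalk_product_right:
  assumes "G.awalk v p w" "a \<in> pverts K"
  shows "KG.awalk (a, v) (map (\<lambda>(x, y). ((a, x), (a, y))) p) (a, w)"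
  using assms by (induction p arbitrary: v) (auto simp: G.awalk_simps KG.awalk_simps)

text \<open>Every arc of the product is a move in one coordinate, so sorting the arcs of
  \<open>p\<close> by coordinate gives its projections to the two factors, with no arc counted
  twice.\<close>

lemma awalk_product_split:
  assumes "KG.awalk (a, v) p (b, w)"
  obtains q r where "K.awalk a q b" "G.awalk v r w" "length p = length q + length r"
proof -
  have "\<exists>q r. K.awalk a q b \<and> G.awalk v r w \<and> length p = length q + length r"
    using assms
  proof (induction p arbitrary: a v)
    case Nil
    then have "K.awalk a [] b" "G.awalk v [] w"
      by (auto simp: K.awalk_simps G.awalk_simps KG.awalk_simps)
    then show ?case by force
  next
    case (Cons e p)
    obtain a' v' where e: "e = ((a, v), (a', v'))"
      and arc: "e \<in> parcs (K \<box> G)" and tl: "KG.awalk (a', v') p (b, w)"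
      using Cons.prems by (cases e) (auto simp: KG.awalk_simps)
    obtain q r where qr: "K.awalk a' q b" "G.awalk v' r w" "length p = length q + length r"
      using Cons.IH[OF tl] by blast
    show ?case
    \<comment> \<open>If both factors have a loop here, the arc qualifies as a move in either
      coordinate; it is then charged to \<open>G\<close>.\<close>
    proof (cases "a = a' \<and> (v, v') \<in> parcs G")
      case True
      then have "G.awalk v ((v, v') # r) w"
        using qr by (simp add: G.awalk_simps)
      with True qr show ?thesis by force
    next
      case False
      then have "v = v'" "K.awalk a ((a, a') # q) b"
        using arc qr by (auto simp: e K.awalk_simps)
      with qr show ?thesis by force
    qed
  qed
  with that show thesis by blast
qed

text \<open>For \<le>, a shortest walk of \<open>K\<close> at height \<open>v\<close> is followed by
  a shortest walk of \<open>G\<close> in the fibre over \<open>b\<close>. For the converse, any walk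
  of the product splits into walks of the factors whose lengths add up to its own.\<close>

lemma graph_dist_product:
  assumes "a \<in> pverts K" "b \<in> pverts K" "v \<in> pverts G" "w \<in> pverts G"
  shows "graph_dist (K \<box> G) (a, v) (b, w) = graph_dist K a b + graph_dist G v w"
proof (rule antisym)
  show "graph_dist (K \<box> G) (a, v) (b, w) \<le> graph_dist K a b + graph_dist G v w"
  proof (cases "graph_dist K a b = \<infinity> \<or> graph_dist G v w = \<infinity>")
    case True
    then show ?thesis by auto
  next
    case False
    obtain p where p: "K.awalk a p b" "graph_dist K a b = ereal (length p)"
      using False K.graph_dist_attained by blast
    obtain q where q: "G.awalk v q w" "graph_dist G v w = ereal (length q)"
      using False G.graph_dist_attained by blast
    have "KG.awalk (a, v) (map (\<lambda>(x, y). ((x, v), (y, v))) p @ map (\<lambda>(x, y). ((b, x), (b, y))) q)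
        (b, w)"
      using awalk_product_left[OF p(1)] awalk_product_right[OF q(1)] assms
      by (blast intro: KG.awalk_appendI)
    from KG.graph_dist_le[OF this] show ?thesis
      by (simp add: p q)
  qed
next
  show "graph_dist K a b + graph_dist G v w \<le> graph_dist (K \<box> G) (a, v) (b, w)"
    unfolding KG.graph_dist_eq_INF
  proof (rule INF_greatest)
    fix p assume "p \<in> {p. KG.awalk (a, v) p (b, w)}"
    then obtain q r where "K.awalk a q b" "G.awalk v r w" "length p = length q + length r"
      using awalk_product_split by blast
    then show "graph_dist K a b + graph_dist G v w \<le> ereal (length p)"
      using add_mono[OF K.graph_dist_le G.graph_dist_le] by fastforce
  qed
qed

end

section \<open>The metric dimension\<close>

text \<open>A vertex resolves itself from any other one, by distance 0 against at least 1. So the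
  \<open>LEAST\<close> in \<open>metric_dimension\<close> ranges over a nonempty set when
  \<open>G\<close> is finite.\<close>

lemma (in pair_wf_digraph) resolving_set_pverts: "resolving_set G (pverts G)"
  unfolding resolving_set_def resolves_def
proof (intro conjI ballI impI subset_refl)
  fix v w assume "v \<in> pverts G" "w \<in> pverts G" "v \<noteq> w"
  then show "\<exists>x\<in>pverts G. graph_dist G v x \<noteq> graph_dist G w x"
    using graph_dist_refl[of v] graph_dist_ge_1[of w v] by (intro bexI[of _ v]) auto
qed

lemma (in pair_fin_digraph) metric_basis:
  obtains S where "resolving_set G S" "finite S" "card S = metric_dimension G"
proof -
  have "\<exists>k S. resolving_set G S \<and> finite S \<and> card S = k"
    using resolving_set_pverts pair_finite_verts by blast
  from LeastI_ex[OF this] that show thesis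
    unfolding metric_dimension_def by blast
qed

lemma metric_dimension_eqI:
  assumes "resolving_set G S" "finite S" "card S = k"
    and "\<And>S. resolving_set G S \<Longrightarrow> finite S \<Longrightarrow> k \<le> card S"
  shows "metric_dimension G = k"
  unfolding metric_dimension_def using assms by (intro Least_equality) auto

lemma (in pair_sym_digraph) graph_dist_connected:
  assumes "connected (with_proj G)" "u \<in> pverts G" "v \<in> pverts G"
  shows "graph_dist G u v \<noteq> \<infinity>"
  using symmetric_connected_imp_strongly_connected[OF pair_sym_arcs assms(1)] assms(2,3)
  by (auto simp: strongly_connected_def graph_dist_eq_infinity_iff)

text \<open>Two copies of \<open>S\<close> inject into \<open>A\<close>; forgetting which copy a
  point comes from yields \<open>g\<close>.\<close>

lemma ex_two_to_one_cover:
  assumes "finite S" "finite A" "2 * card S \<le> card A" "S \<subseteq> V" "V \<noteq> {}"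
  obtains g where "g \<in> A \<rightarrow> V"
    and "\<And>s. s \<in> S \<Longrightarrow> \<exists>i\<in>A. \<exists>j\<in>A. i \<noteq> j \<and> g i = s \<and> g j = s"
proof -
  have "card (S \<times> (UNIV :: bool set)) \<le> card A"
    using assms by (simp add: card_cartesian_product)
  then obtain f where f: "f ` (S \<times> (UNIV :: bool set)) \<subseteq> A" "inj_on f (S \<times> UNIV)"
    using assms inj_on_iff_card_le[of "S \<times> (UNIV :: bool set)" A] by auto
  obtain v where "v \<in> V" using assms by blast
  \<comment> \<open>Indices outside the image of \<open>f\<close> get an arbitrary value
    \<open>v\<close> in \<open>V\<close>.\<close>
  define g where "g i = (if i \<in> f ` (S \<times> UNIV) then fst (the_inv_into (S \<times> UNIV) f i) else v)" for i
  have g_f: "g (f (s, t)) = s" if "s \<in> S" for s t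
    using that f(2) by (simp add: g_def the_inv_into_f_f)
  show thesis
  proof
    show "g \<in> A \<rightarrow> V"
    proof
      fix i assume "i \<in> A"
      show "g i \<in> V"
      proof (cases "i \<in> f ` (S \<times> UNIV)")
        case True
        then show ?thesis using g_f assms by auto
      next
        case False
        then show ?thesis using \<open>v \<in> V\<close> by (simp add: g_def)
      qed
    qed
    fix s assume s: "s \<in> S"
    have "f (s, True) \<noteq> f (s, False)"
      using f(2) s by (auto dest: inj_onD)
    moreover have "f (s, t) \<in> A" for t
      using f(1) s by auto
    ultimately show "\<exists>i\<in>A. \<exists>j\<in>A. i \<noteq> j \<and> g i = s \<and> g j = s"
      using g_f[OF s] by blast
  qed
qed

section \<open>Bounds for the product of a complete and a connected graph\<close>

context
  fixes K :: "'a pair_pre_digraph" and G :: "'b pair_pre_digraph" and n :: nat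
  assumes G: "pair_graph G" and conn: "connected (with_proj G)"
    and K: "complete_digraph n (with_proj K)"
begin

lemma pverts_nonempty: "pverts G \<noteq> {}"
  using conn by (simp add: connected_conv)

lemma card_pverts: "card (pverts K) = n" "finite (pverts K)"
  using K by (simp_all only: complete_digraph_pair_def)

lemma graph_dist_complete_product:
  assumes "a \<in> pverts K" "b \<in> pverts K" "v \<in> pverts G" "w \<in> pverts G"
  shows "graph_dist (K \<box> G) (a, v) (b, w) = (if a = b then 0 else 1) + graph_dist G v w"
proof -
  have "pair_fin_digraph_product K G"
    using pair_graphI_complete[OF K] G
    by (simp add: pair_fin_digraph_product_def pair_graph_def pair_digraph_def)
  from pair_fin_digraph_product.graph_dist_product[OF this assms] show ?thesis
    using assms by (simp add: graph_dist_complete[OF K])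
qed

lemma card_resolving_set_ge:
  assumes S: "resolving_set (K \<box> G) S" and "finite S"
  shows "n - 1 \<le> card S"
proof (rule ccontr)
  assume "\<not> n - 1 \<le> card S"
  moreover have "card (fst ` S) \<le> card S"
    using \<open>finite S\<close> by (rule card_image_le)
  moreover have "card (pverts K) - card (fst ` S) \<le> card (pverts K - fst ` S)"
    using \<open>finite S\<close> by (intro diff_card_le_card_Diff) simp
  ultimately have "2 \<le> card (pverts K - fst ` S)"
    using card_pverts(1) by linarith
  then obtain a b where ab: "a \<in> pverts K - fst ` S" "b \<in> pverts K - fst ` S" "a \<noteq> b"
    by (auto simp: numeral_2_eq_2 card_le_Suc_iff)
  obtain v where v: "v \<in> pverts G" using pverts_nonempty by blast
  have "\<exists>x\<in>S. resolves (K \<box> G) x (a, v) (b, v)"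
    using S ab v by (auto simp: resolving_set_def)
  then obtain c w where cw: "(c, w) \<in> S" "resolves (K \<box> G) (c, w) (a, v) (b, v)"
    by auto
  \<comment> \<open>As \<open>c\<close> lies in a fibre met by \<open>S\<close>, both
    \<open>(a, v)\<close> and \<open>(b, v)\<close> are at distance 1 + d(v, w) from
    \<open>(c, w)\<close>.\<close>
  moreover have "c \<noteq> a" "c \<noteq> b"
    using cw(1) ab by force+
  moreover have "c \<in> pverts K" "w \<in> pverts G"
    using S cw(1) by (auto simp: resolving_set_def)
  ultimately show False
    using ab v by (simp add: resolves_def graph_dist_complete_product)
qed

lemma ex_resolving_set:
  assumes "2 * metric_dimension G + 1 \<le> n"
  obtains T where "resolving_set (K \<box> G) T" "finite T" "card T = n - 1"
proof -
  interpret G: pair_graph G by (rule G)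
  obtain S where S: "resolving_set G S" "finite S" "card S = metric_dimension G"
    by (rule G.metric_basis)
  have "pverts K \<noteq> {}" using card_pverts(1) assms by auto
  then obtain z where z: "z \<in> pverts K" by blast
  \<comment> \<open>Leaving out one fibre keeps \<open>n - 1\<close> indices, which by hypothesis is
    at least twice the size of \<open>S\<close>.\<close>
  define A where "A = pverts K - {z}"
  have A: "finite A" "card A = n - 1" "A \<subseteq> pverts K"
    using card_pverts z by (auto simp: A_def)
  obtain g where g: "g \<in> A \<rightarrow> pverts G"
    and twice: "\<And>s. s \<in> S \<Longrightarrow> \<exists>i\<in>A. \<exists>j\<in>A. i \<noteq> j \<and> g i = s \<and> g j = s"
  proof (rule ex_two_to_one_cover)
    show "2 * card S \<le> card A" using S A assms by simp
    show "S \<subseteq> pverts G" using S by (simp add: resolving_set_def)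
  qed (use S A pverts_nonempty in auto)
  define T where "T = (\<lambda>i. (i, g i)) ` A"
  have dist: "graph_dist (K \<box> G) (a, v) (i, g i) = (if a = i then 0 else 1) + graph_dist G v (g i)"
    if "i \<in> A" "a \<in> pverts K" "v \<in> pverts G" for a v i
    using that g A(3) by (auto simp: graph_dist_complete_product Pi_iff subset_iff)
  have "resolving_set (K \<box> G) T"
    unfolding resolving_set_def
  proof (intro conjI ballI impI)
    show "T \<subseteq> pverts (K \<box> G)" using g A by (auto simp: T_def)
    fix x y assume xy: "x \<in> pverts (K \<box> G)" "y \<in> pverts (K \<box> G)" "x \<noteq> y"
    obtain a v b w where x: "x = (a, v)" and y: "y = (b, w)"
      by (cases x, cases y)
    have in_verts: "a \<in> pverts K" "b \<in> pverts K" "v \<in> pverts G" "w \<in> pverts G"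
      using xy by (auto simp: x y)
    have "\<exists>i\<in>A. graph_dist (K \<box> G) (a, v) (i, g i) \<noteq> graph_dist (K \<box> G) (b, w) (i, g i)"
    proof (cases "v = w")
      case True
      with xy have "a \<noteq> b" by (simp add: x y)
      \<comment> \<open>At most one of \<open>a\<close>, \<open>b\<close> is the omitted
        \<open>z\<close>. The point of \<open>T\<close> over the other one sees distances d and 1 +
        d, which differ because connectedness makes d finite.\<close>
      then have "a \<in> A \<or> b \<in> A" using in_verts by (auto simp: A_def)
      then obtain i where i: "i \<in> A" "i = a \<or> i = b" by blast
      then have "graph_dist G v (g i) \<noteq> \<infinity>"
        using G.graph_dist_connected[OF conn] in_verts g by (auto simp: Pi_iff)
      then have "graph_dist G v (g i) \<noteq> 1 + graph_dist G v (g i)"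
        using G.graph_dist_nonneg[of v "g i"]
        by (cases "graph_dist G v (g i)") (auto simp: one_ereal_def)
      then show ?thesis
        using i \<open>a \<noteq> b\<close> True in_verts by (intro bexI[of _ i]) (auto simp: dist)
    next
      case False
      then obtain s where s: "s \<in> S" "graph_dist G v s \<noteq> graph_dist G w s"
        using S(1) in_verts unfolding resolving_set_def resolves_def by blast
      obtain i j where ij: "i \<in> A" "j \<in> A" "i \<noteq> j" "g i = s" "g j = s"
        using twice[OF s(1)] by blast
      show ?thesis
      proof (rule ccontr)
        assume "\<not> ?thesis"
        then have eq: "(if a = i then 0 else 1) + graph_dist G v (g i) =
            (if b = i then 0 else 1) + graph_dist G w (g i)" if "i \<in> A" for i
          using that in_verts dist by metis
        show False
          \<comment> \<open>Equality at \<open>i\<close> with different distances to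
            \<open>s\<close> forces exactly one of \<open>a\<close>, \<open>b\<close> to equal
            \<open>i\<close>, and likewise for \<open>j\<close>. Since \<open>i\<close> and
            \<open>j\<close> differ, the two equations shift by 1 in opposite directions. The case
            split disposes of infinite values.\<close>
          using eq[OF ij(1)] eq[OF ij(2)] ij(4,5)
            s(2) ij(3) G.graph_dist_nonneg[of v s] G.graph_dist_nonneg[of w s]
          by (cases "graph_dist G v s"; cases "graph_dist G w s")
            (auto simp: one_ereal_def split: if_splits)
      qed
    qed
    then show "\<exists>z\<in>T. resolves (K \<box> G) z x y"
      by (auto simp: T_def resolves_def x y)
  qed
  moreover have "finite T" "card T = n - 1"
    using A by (auto simp: T_def card_image inj_on_def)
  ultimately show thesis using that by blast
qed

end

theorem theorem5p3:
  fixes G :: "'a pair_pre_digraph" and K :: "'b pair_pre_digraph" and n :: nat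
  assumes "pair_graph G"
    and "connected (with_proj G)"
    and "complete_digraph n (with_proj K)"
    and "n \<ge> 2 * metric_dimension G + 1"
  shows "metric_dimension (K \<box> G) = n - 1"
proof -
  obtain T where "resolving_set (K \<box> G) T" "finite T" "card T = n - 1"
    using ex_resolving_set[OF assms] by blast
  then show ?thesis
    using card_resolving_set_ge[OF assms(1-3)] by (rule metric_dimension_eqI)
qed

end
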